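(* Suppose $m_0>1$ and the lion plays the Moving Center Lion Strategy. Then, for any man strategy, the lion captures the man in a finite number of moves, and an upper bound to the maximum number of moves before the game ends is $N_{max}^{MCLS}=\min\{t\in\mathbb{N}: b_t<0\}$, where $b_0=m_0$ and $$b_{t+1}=\frac{b_t(b_t-1)}{\sqrt{1+b_t^2}-1}.$$
   Context: Game. Two players, a man and a lion, occupy points $M_t,L_t\in\mathbb{R}^2_+$ (the closed non-negative quadrant) at times $t=0,1,2,\dots$. In each round the man moves first, from $M_t$ to any $M_{t+1}\in\mathbb{R}^2_+$ with $\|M_{t+1}-M_t\|\le 1$; then the lion moves from $L_t$ to $L_{t+1}\in\mathbb{R}^2_+$ with $\|L_{t+1}-L_t\|\le 1$ (Euclidean norm). The game ends (the lion captures the man) if the lion moves exactly to the man's position. Standing assumption: both coordinates of $M_0$ are strictly smaller than the corresponding coordinates of $L_0$. Center. Given $M_t,L_t$, the center at time $t$ is the point $C_t=[x_t,y_t]'\in\mathbb{R}^2_+$ such that $C_t=L_t+\eta(L_t-M_t)$ with $\eta>0$ and $\|C_t-L_t\|=\max\{x_t,y_t\}$. Put $m_t=\min\{x_t,y_t\}$; in particular $m_0$ is the smallest coordinate of the initial center $C_0$. Moving Center Lion Strategy (MCLS). When the man moves from $M_t$ to $M_{t+1}$: the lion computes the center $C_t$ from $M_t$ and $L_t$; if $\|M_{t+1}-L_t\|\le 1$, the lion moves to $M_{t+1}$ and catches the man; otherwise the lion moves to a point $L_{t+1}$ on the line connecting $M_{t+1}$ to $C_t$ with unitary distance from $L_t$,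 choosing, of the two such points, the one farther from $C_t$.
   Formalization: For exceptional m_0 some b_t equals 0 (when an earlier term is 1), and the recursion then reads 0/0; the formal statement sets b_{t+1} = −∞ there (the limit from above), so the first negative index exists for every m_0. *)

theory Defs
  imports "HOL-Analysis.Analysis"
begin

type_synonym point = "real^2"

definition quadrant :: "point set" where
  "quadrant = {p. 0 \<le> p$1 \<and> 0 \<le> p$2}"

definition legal_move :: "point \<Rightarrow> point \<Rightarrow> bool" where
  "legal_move p q \<longleftrightarrow> q \<in> quadrant \<and> norm (q - p) \<le> 1"

definition is_center :: "point \<Rightarrow> point \<Rightarrow> point \<Rightarrow> bool" where
  "is_center M L C \<longleftrightarrow> C \<in> quadrant \<and> (\<exists>\<eta>>0. C = L + \<eta> *\<^sub>R (L - M)) \<and>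
     norm (C - L) = max (C$1) (C$2)"

definition center :: "point \<Rightarrow> point \<Rightarrow> point" where
  "center M L = (THE C. is_center M L C)"

definition min_coord :: "point \<Rightarrow> real" where
  "min_coord p = min (p$1) (p$2)"

text \<open>With man at \<open>M\<close>, lion at \<open>L\<close> and center \<open>C\<close>, the man has just moved to \<open>M'\<close>:
  \<open>L'\<close> is the point, among those of the line through \<open>M'\<close> and \<open>C\<close> at distance 1 from \<open>L\<close>,
  that is farther from \<open>C\<close>.\<close>

definition is_mcls_point :: "point \<Rightarrow> point \<Rightarrow> point \<Rightarrow> point \<Rightarrow> bool" where
  "is_mcls_point C L M' L' \<longleftrightarrow>
     L' \<in> affine hull {M', C} \<and> norm (L' - L) = 1 \<and>
     (\<forall>P \<in> affine hull {M', C}. norm (P - L) = 1 \<longrightarrow> norm (P - C) \<le> norm (L' - C))"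

definition mcls :: "point \<Rightarrow> point \<Rightarrow> point \<Rightarrow> point" where
  "mcls M L M' =
     (if norm (M' - L) \<le> 1 then M' else (THE L'. is_mcls_point (center M L) L M' L'))"

text \<open>The lion's answer to \<open>M'\<close> is well-defined (the definite descriptions above denote) and
  obeys the rules of the game. No center is needed when the lion can catch the man at once.\<close>

definition mcls_admissible :: "point \<Rightarrow> point \<Rightarrow> point \<Rightarrow> bool" where
  "mcls_admissible M L M' \<longleftrightarrow>
     (norm (M' - L) > 1 \<longrightarrow>
        (\<exists>!C. is_center M L C) \<and> (\<exists>!L'. is_mcls_point (center M L) L M' L')) \<and>
     legal_move L (mcls M L M')"

text \<open>A man strategy maps the positions \<open>[(M\<^sub>0, L\<^sub>0), \<dots>, (M\<^sub>t, L\<^sub>t)]\<close> reached so far to the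
  next position of the man.\<close>

type_synonym man_strategy = "(point \<times> point) list \<Rightarrow> point"

definition legal_man_strategy :: "man_strategy \<Rightarrow> bool" where
  "legal_man_strategy \<sigma> \<longleftrightarrow>
     (\<forall>h. h \<noteq> [] \<and> set h \<subseteq> quadrant \<times> quadrant \<longrightarrow> legal_move (fst (last h)) (\<sigma> h))"

text \<open>The play is continued formally after a capture; from then on \<open>mcls\<close> keeps the lion on
  the man, so only the first capture time matters.\<close>

primrec mcls_history :: "man_strategy \<Rightarrow> point \<Rightarrow> point \<Rightarrow> nat \<Rightarrow> (point \<times> point) list" where
  "mcls_history \<sigma> M0 L0 0 = [(M0, L0)]"
| "mcls_history \<sigma> M0 L0 (Suc t) =
     (let h = mcls_history \<sigma> M0 L0 t; M' = \<sigma> h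
      in h @ [(M', mcls (fst (last h)) (snd (last h)) M')])"

definition man_pos :: "man_strategy \<Rightarrow> point \<Rightarrow> point \<Rightarrow> nat \<Rightarrow> point" where
  "man_pos \<sigma> M0 L0 t = fst (last (mcls_history \<sigma> M0 L0 t))"

definition lion_pos :: "man_strategy \<Rightarrow> point \<Rightarrow> point \<Rightarrow> nat \<Rightarrow> point" where
  "lion_pos \<sigma> M0 L0 t = snd (last (mcls_history \<sigma> M0 L0 t))"

definition captured_at :: "man_strategy \<Rightarrow> point \<Rightarrow> point \<Rightarrow> nat \<Rightarrow> bool" where
  "captured_at \<sigma> M0 L0 t \<longleftrightarrow> lion_pos \<sigma> M0 L0 t = man_pos \<sigma> M0 L0 t"

text \<open>The right-hand side of \<open>b\<^sub>t\<^sub>+\<^sub>1 = b\<^sub>t (b\<^sub>t - 1) / (sqrt (1 + b\<^sub>t\<^sup>2) - 1)\<close> is \<open>0/0\<close> at \<open>b\<^sub>t = 0\<close>,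
  a value that is reached for exceptional \<open>m\<^sub>0\<close> (those with some \<open>b\<^sub>s = 1\<close>). There we take its
  limit for \<open>b\<^sub>t\<close> tending to \<open>0\<close> from above, \<open>-\<infinity>\<close>; the real-number convention \<open>0/0 = 0\<close>
  would keep the sequence at \<open>0\<close>, so that no term would be negative. Terms after the first
  negative one play no role.\<close>

definition bound_step :: "real \<Rightarrow> ereal" where
  "bound_step b = (if b = 0 then -\<infinity> else ereal (b * (b - 1) / (sqrt (1 + b\<^sup>2) - 1)))"

primrec bound_seq :: "real \<Rightarrow> nat \<Rightarrow> ereal" where
  "bound_seq m0 0 = ereal m0"
| "bound_seq m0 (Suc t) = bound_step (real_of_ereal (bound_seq m0 t))"

definition N_max :: "real \<Rightarrow> nat" where
  "N_max m0 = (LEAST t. bound_seq m0 t < 0)"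

end

(* With C the current center and r = |C - L| its largest coordinate, put w = |C - M'| and
   s = |C - L'| after the man has escaped to M'.  Then r < s < w and s^2 >= 1 + r^2, and the new
   center C' lies on the segment from L' to C, at distance s - r' from C, where r' = |C' - L'|
   is the largest coordinate of C'.  As L' lies in the quadrant, the direction (v1, v2) of C - L'
   satisfies s v_i <= C_i; combined with s^2 >= 1 + r^2 this makes the center move far enough
   for its smallest coordinate m to satisfy m' <= f(m), where f is the recursion function of the
   bound, and forces m > 1 whenever the man escapes.  Since f is increasing on [1, oo), the
   bound b_t dominates m_t as long as the man is free, while m_t stays positive; and b_t
   decreases by at least 1/(2 m_0) per round as long as it is positive. *)
theory Submission
  imports Defs
begin

section \<open>The triangles at the center: where the lion lands\<close>

text \<open>Law of cosines in the triangles at the center \<open>C\<close>: \<open>r\<close>, \<open>\<rho>\<close>, \<open>w\<close>, \<open>s\<close> are the distances from \<open>C\<close> to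
  \<open>L\<close>, \<open>M\<close>, \<open>M'\<close>, \<open>L'\<close>, and \<open>c\<close> is the cosine of the angle at \<open>C\<close> between \<open>L\<close> and \<open>M'\<close>.\<close>

lemma farther_unit_circle_intersection:
  fixes r \<rho> w c :: real
  assumes "0 < r" "r < \<rho>" "0 < w" "c \<le> 1"
    and near: "w\<^sup>2 + \<rho>\<^sup>2 - 2 * w * \<rho> * c \<le> 1" and far: "1 < w\<^sup>2 + r\<^sup>2 - 2 * w * r * c"
  obtains s where "0 < s" "s < w" "1 + r\<^sup>2 \<le> s\<^sup>2" "r\<^sup>2 + s\<^sup>2 - 2 * r * s * c = 1" "r < w * c"
    "\<And>t. r\<^sup>2 + t\<^sup>2 - 2 * r * t * c = 1 \<Longrightarrow> t \<noteq> s \<Longrightarrow> \<bar>t\<bar> < s"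
proof -
  \<comment> \<open>\<open>M'\<close> is nearer to \<open>M\<close> than to \<open>L\<close>, so its
    projection on the line, at distance \<open>w * c\<close> from the center, lies beyond the
    midpoint of \<open>L\<close> and \<open>M\<close>. Algebraically, subtract \<open>near\<close>
    from \<open>far\<close> and cancel \<open>\<rho> - r\<close>.\<close>
  have "(\<rho> - r) * (\<rho> + r) < (\<rho> - r) * (2 * w * c)"
    using near far by (simp add: algebra_simps power2_eq_square)
  hence rho: "\<rho> + r < 2 * w * c" using assms(2) by simp
  hence rw: "r < w * c" using assms(2) by simp
  have "0 < w * c" using rw assms(1) by linarith
  hence c0: "0 < c" using assms(3) by (simp add: zero_less_mult_iff)
  have "w * c \<le> w" using assms(3,4) by simp
  \<comment> \<open>The squared sine of the angle at \<open>C\<close>; \<open>w\<^sup>2 * k\<close>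
    is the squared distance of \<open>M'\<close> from the line through \<open>L\<close> and
    \<open>M\<close>, hence at most 1.\<close>
  define k where "k = 1 - c\<^sup>2"
  have k0: "0 \<le> k" "k < 1" using c0 assms(4) unfolding k_def
    by (auto simp: power_le_one)
  have "w\<^sup>2 * k + (\<rho> - w * c)\<^sup>2 \<le> 1"
    using near unfolding k_def by (simp add: algebra_simps power2_eq_square)
  hence wk: "w\<^sup>2 * k \<le> 1" by (smt (verit) zero_le_power2)
  have "r\<^sup>2 \<le> (w * c)\<^sup>2" using rw assms(1) by (intro power_mono) auto
  hence "r\<^sup>2 * k \<le> (w * c)\<^sup>2 * k" using k0 by (intro mult_right_mono) auto
  also have "\<dots> = (w\<^sup>2 * k) * c\<^sup>2" by (simp add: power_mult_distrib)
  also have "\<dots> \<le> 1 * c\<^sup>2" using wk by (intro mult_right_mono) auto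
  finally have rk: "r\<^sup>2 * k \<le> c\<^sup>2" by simp
  \<comment> \<open>A quarter of the discriminant of the equation
    \<open>r\<^sup>2 + t\<^sup>2 - 2 * r * t * c = 1\<close> in \<open>t\<close>; \<open>s\<close>
    below is its larger root.\<close>
  define D where "D = 1 - r\<^sup>2 * k"
  have Dk: "k \<le> D" using rk unfolding D_def k_def by simp
  have D0: "0 < D"
  proof (cases "k = 0")
    case False thus ?thesis using k0 Dk by simp
  qed (simp add: D_def)
  define q where "q = sqrt D"
  have q0: "0 < q" and q2: "q\<^sup>2 = D" using D0 by (auto simp: q_def)
  define s where "s = r * c + q"
  have s0: "0 < s" using c0 q0 assms(1) by (simp add: s_def add_pos_pos)
  have root: "r\<^sup>2 + t\<^sup>2 - 2 * r * t * c - 1 = (t - s) * (t - (r * c - q))" for t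
  proof -
    have "(t - s) * (t - (r * c - q)) = t\<^sup>2 - 2 * r * t * c + (r * c)\<^sup>2 - q\<^sup>2"
      unfolding s_def by (simp add: algebra_simps power2_eq_square)
    also have "\<dots> = r\<^sup>2 + t\<^sup>2 - 2 * r * t * c - 1"
      unfolding q2 D_def k_def by (simp add: algebra_simps power2_eq_square)
    finally show ?thesis by simp
  qed
  have rts: "r\<^sup>2 + s\<^sup>2 - 2 * r * s * c = 1" using root[of s] by simp
  \<comment> \<open>By \<open>far\<close> the quadratic is positive at \<open>w\<close>; since
    \<open>w\<close> exceeds the smaller root, it exceeds the larger one too.\<close>
  have "0 < (w - s) * (w - (r * c - q))" using root[of w] far by (simp add: algebra_simps)
  moreover have "0 < w - (r * c - q)"
  proof -
    have "r * c \<le> r" using assms(1,4) by simp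
    thus ?thesis using rw \<open>w * c \<le> w\<close> q0 by linarith
  qed
  ultimately have sw: "s < w" by (simp add: zero_less_mult_iff)
  \<comment> \<open>The target is \<open>r \<le> s * c\<close>, which is
    \<open>r * k \<le> c * q\<close> once \<open>s\<close> is expanded: the angle at
    \<open>L\<close> is not acute, and the root equation then yields
    \<open>1 + r\<^sup>2 \<le> s\<^sup>2\<close>.\<close>
  have "(r * k)\<^sup>2 \<le> (c * q)\<^sup>2"
  proof -
    have "(r * k)\<^sup>2 = (r\<^sup>2 * k) * k" by (simp add: power2_eq_square)
    also have "\<dots> \<le> c\<^sup>2 * D" using rk Dk k0 by (intro mult_mono) auto
    finally show ?thesis by (simp add: power_mult_distrib q2)
  qed
  hence "r * k \<le> c * q" using c0 q0 by - (rule power2_le_imp_le, auto)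
  hence "r \<le> s * c" unfolding s_def k_def by (simp add: algebra_simps power2_eq_square)
  hence "r * r \<le> r * (s * c)" using assms(1) by simp
  hence s2: "1 + r\<^sup>2 \<le> s\<^sup>2" using rts by (simp add: algebra_simps power2_eq_square)
  \<comment> \<open>The two roots have the positive sum \<open>2 * r * c\<close>, so the larger one
    also has the larger absolute value.\<close>
  have "\<bar>t\<bar> < s" if "r\<^sup>2 + t\<^sup>2 - 2 * r * t * c = 1" "t \<noteq> s" for t
  proof -
    have "t = r * c - q" using root[of t] that by simp
    moreover have "0 < r * c" using c0 assms(1) by simp
    ultimately show ?thesis using q0 unfolding s_def by linarith
  qed
  thus thesis using that s0 sw s2 rts rw by blast
qed

section \<open>The recursion function and the decrease of the smallest coordinate\<close>

definition next_bound :: "real \<Rightarrow> real" where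
  "next_bound b = b * (b - 1) / (sqrt (1 + b\<^sup>2) - 1)"

text \<open>Rationalising the denominator exposes the factor \<open>b - 1\<close>; all later
  estimates start from this form.\<close>

lemma next_bound_eq:
  assumes "0 < b"
  shows "next_bound b = (b - 1) * (sqrt (1 + b\<^sup>2) + 1) / b"
proof -
  let ?s = "sqrt (1 + b\<^sup>2)"
  have "(?s - 1) * (?s + 1) = b\<^sup>2" by (simp add: algebra_simps)
  hence e: "(?s - 1) * (?s + 1) = b * b" by (simp add: power2_eq_square)
  moreover have "?s - 1 \<noteq> 0" using assms by simp
  ultimately show ?thesis using assms unfolding next_bound_def
    by (simp add: frac_eq_eq mult_ac)
qed

text \<open>Here (x, y) is the old center, (u1, u2) the unit direction from \<open>L'\<close> to it,
  \<open>s\<close> their distance and \<open>e\<close> the shift of the center against that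
  direction. The equation for the new radius \<open>s - e\<close> determines \<open>e\<close>, and
  the lower bound on \<open>s\<close> makes the shift large.\<close>

lemma center_coordinate_decrease:
  fixes x y s e u1 u2 :: real
  assumes "0 < y" "y \<le> x" "0 < u1" "0 < u2" "u1\<^sup>2 + u2\<^sup>2 = 1" "0 < s"
    and s2: "1 + x\<^sup>2 \<le> s\<^sup>2" and "s * u1 \<le> x" "s * u2 \<le> y"
    and radius: "s - e = max (x - e * u1) (y - e * u2)"
    and "0 < x - e * u1" "0 < y - e * u2"
  shows "1 < y \<and> min (x - e * u1) (y - e * u2) \<le> next_bound y"
proof -
  define S where "S = sqrt (1 + x\<^sup>2)"
  define T where "T = sqrt (1 + y\<^sup>2)"
  have S: "S\<^sup>2 = 1 + x\<^sup>2" "0 < S" and T: "T\<^sup>2 = 1 + y\<^sup>2" "0 < T"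
    by (auto simp: S_def T_def add_pos_nonneg)
  have x0: "0 < x" using assms by simp
  have xy2: "y\<^sup>2 \<le> x\<^sup>2" using assms by (intro power_mono) auto
  have Ss: "S \<le> s" using s2 S \<open>0 < s\<close> by - (rule power2_le_imp_le, auto)
  have xS: "x < S" using S x0 by - (rule power2_less_imp_less[of x S], auto)
  have yT: "y < T" using T \<open>0 < y\<close> by - (rule power2_less_imp_less[of y T], auto)
  have TS: "T \<le> S" using S T xy2 by - (rule power2_le_imp_le, auto)
  have u1u1: "u2\<^sup>2 = (1 - u1) * (1 + u1)" "u1\<^sup>2 = (1 - u2) * (1 + u2)"
    using assms(5) by (simp_all add: algebra_simps power2_eq_square)
  have "0 < (1 - u1) * (1 + u1)" "0 < (1 - u2) * (1 + u2)"
    using assms(3,4) unfolding u1u1[symmetric] by simp_all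
  hence u1lt: "u1 < 1" "u2 < 1" using assms(3,4) by (auto simp: zero_less_mult_iff)
  have nb: "next_bound y = (y - 1) * (T + 1)/y" using next_bound_eq[OF assms(1)] unfolding T_def .
  have STx: "(S - x) * (S + x) = 1" "(T - y) * (T + y) = 1"
    using S T by (simp_all add: algebra_simps power2_eq_square)
  show ?thesis
  \<comment> \<open>The cases tell which new coordinate equals the radius; the bound is proved for
    the other one.\<close>
  proof (cases "s - e = x - e * u1")
    case True
    hence e: "e * (1 - u1) = s - x" by (simp add: algebra_simps)
    \<comment> \<open>A lower bound for \<open>s * u1\<close>: subtract
      \<open>(s * u2)\<^sup>2 \<le> y\<^sup>2\<close> from
      \<open>1 + x\<^sup>2 \<le> s\<^sup>2\<close>.\<close>
    define q where "q = sqrt (1 + x\<^sup>2 - y\<^sup>2)"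
    have q: "q\<^sup>2 = 1 + x\<^sup>2 - y\<^sup>2" "0 < q" using xy2 by (auto simp: q_def)
    have q1: "1 \<le> q" using q xy2 by (simp add: q_def)
    have "0 < e * (1 - u1)" using e Ss xS by simp
    hence "0 \<le> e" using u1lt by (simp add: zero_less_mult_iff)
    have "(s * u2)\<^sup>2 \<le> y\<^sup>2" using assms by (intro power_mono) auto
    moreover have "(s * u1)\<^sup>2 + (s * u2)\<^sup>2 = s\<^sup>2"
      using assms(5) by (metis distrib_left mult.right_neutral power_mult_distrib)
    ultimately have "q\<^sup>2 \<le> (s * u1)\<^sup>2" using s2 q by linarith
    hence qs: "q \<le> s * u1" using assms by - (rule power2_le_imp_le, auto)
    have "(S - x) * (S + q) \<le> (s - x) * (s + s * u1)"
      using Ss xS qs q S by (intro mult_mono) auto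
    also have "\<dots> = (e * u2) * (s * u2)"
    proof -
      have "(s - x) * (s + s * u1) = (e * s) * ((1 - u1) * (1 + u1))"
        unfolding e[symmetric] by (simp add: algebra_simps)
      also have "\<dots> = (e * u2) * (s * u2)"
        unfolding u1u1(1)[symmetric] by (simp add: power2_eq_square)
      finally show ?thesis .
    qed
    also have "\<dots> \<le> (e * u2) * y" using \<open>0 \<le> e\<close> assms by (intro mult_left_mono) auto
    finally have low: "(y - e * u2) * y \<le> y\<^sup>2 - (S - x) * (S + q)"
      by (simp add: algebra_simps power2_eq_square)
    \<comment> \<open>With \<open>low\<close>, this bounds \<open>(y - e * u2) * y\<close> by
      \<open>y\<^sup>2 - 1 + (S - x) * (x - q)\<close>. For x = y one has S = T and q = 1, and the
      bound is the right-hand side of \<open>id2\<close>; the remaining steps show that x = y is the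
      worst case.\<close>
    have id1: "(S - x) * (S + q) = 1 - (S - x) * (x - q)" using STx(1) by (simp add: algebra_simps)
    have id2: "y\<^sup>2 - 1 + (T - y) * (y - 1) = (y - 1) * (T + 1)"
      by (simp add: algebra_simps power2_eq_square)
    have pos: "0 < (y - e * u2) * y" using assms by simp
    have xq: "(x - q) * (x + q) = (y - 1) * (y + 1)" using q by (simp add: algebra_simps power2_eq_square)
    \<comment> \<open>For y \<le> 1 both \<open>y\<^sup>2 - 1\<close> and \<open>x - q\<close> are
      at most 0, against the positivity in \<open>pos\<close>.\<close>
    have y1: "1 < y"
    proof (rule ccontr)
      assume "\<not> 1 < y"
      hence y: "y \<le> 1" by simp
      hence "y\<^sup>2 \<le> 1" using assms by (simp add: power_le_one)
      moreover have "x\<^sup>2 \<le> q\<^sup>2" using q calculation by simp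
      hence "x \<le> q" using q by - (rule power2_le_imp_le, auto)
      hence "(S - x) * (x - q) \<le> 0" using xS by (intro mult_nonneg_nonpos) auto
      ultimately show False using low id1 pos by linarith
    qed
    \<comment> \<open>By \<open>STx\<close> the two sides are the reciprocals of
      \<open>S + x\<close> and \<open>T + y\<close>.\<close>
    have "S - x \<le> T - y"
    proof -
      have "(S - x) * (T + y) \<le> (S - x) * (S + x)" using xS TS assms(2) by (intro mult_left_mono) auto
      also have "\<dots> = (T - y) * (T + y)" using STx by simp
      finally show ?thesis using T assms(1) by simp
    qed
    moreover have "x - q \<le> y - 1"
    proof -
      have "(x - q) * (x + q) \<le> (y - 1) * (x + q)"
        unfolding xq using y1 assms(2) q1 by (intro mult_left_mono) auto
      thus ?thesis using x0 q by simp
    qed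
    ultimately have "(S - x) * (x - q) \<le> (T - y) * (y - 1)"
      using xS y1 by (intro order_trans[OF mult_left_mono mult_right_mono]) auto
    hence "(y - e * u2) * y \<le> (y - 1) * (T + 1)" using low id1 id2 by linarith
    hence "y - e * u2 \<le> next_bound y" unfolding nb using assms(1) by (simp add: pos_le_divide_eq)
    thus ?thesis using y1 by simp
  next
    case False
    hence e: "e * (1 - u2) = s - y" using radius by (auto simp: max_def algebra_simps split: if_splits)
    have sy: "0 < s - y" using Ss xS assms(2) by simp
    have "0 < e * (1 - u2)" using e sy by simp
    hence "0 \<le> e" using u1lt by (simp add: zero_less_mult_iff)
    have "(s * u1)\<^sup>2 \<le> x\<^sup>2" using assms by (intro power_mono) auto
    moreover have "(s * u1)\<^sup>2 + (s * u2)\<^sup>2 = s\<^sup>2"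
      using assms(5) by (metis distrib_left mult.right_neutral power_mult_distrib)
    ultimately have "1\<^sup>2 \<le> (s * u2)\<^sup>2" using s2 by simp
    hence qs: "1 \<le> s * u2" using assms by - (rule power2_le_imp_le[of 1], auto)
    have "(S - y) * (S + 1) \<le> (s - y) * (s + s * u2)"
      using Ss xS qs S assms(2) sy by (intro mult_mono) auto
    also have "\<dots> = (e * u1) * (s * u1)"
    proof -
      have "(s - y) * (s + s * u2) = (e * s) * ((1 - u2) * (1 + u2))"
        unfolding e[symmetric] by (simp add: algebra_simps)
      also have "\<dots> = (e * u1) * (s * u1)"
        unfolding u1u1(2)[symmetric] by (simp add: power2_eq_square)
      finally show ?thesis .
    qed
    also have "\<dots> \<le> (e * u1) * x" using \<open>0 \<le> e\<close> assms by (intro mult_left_mono) auto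
    finally have "(x - e * u1) * x \<le> x\<^sup>2 - (S - y) * (S + 1)"
      by (simp add: algebra_simps power2_eq_square)
    also have "\<dots> = (y - 1) * (S + 1)" using S by (simp add: algebra_simps power2_eq_square)
    finally have low: "(x - e * u1) * x \<le> (y - 1) * (S + 1)" .
    moreover have "0 < (x - e * u1) * x" using assms x0 by simp
    ultimately have "0 < (y - 1) * (S + 1)" by linarith
    hence y1: "1 < y" using S by (simp add: zero_less_mult_iff)
    \<comment> \<open>Passes from x to y: the quotient \<open>(sqrt (1 + z\<^sup>2) + 1) / z\<close>
      decreases in z > 0.\<close>
    have "(S * y)\<^sup>2 \<le> (T * x)\<^sup>2" using S T xy2 by (simp add: power_mult_distrib algebra_simps)
    hence "S * y \<le> T * x" using T x0 by - (rule power2_le_imp_le, auto)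
    hence "(S + 1) * y \<le> (T + 1) * x" using assms(2) by (simp add: algebra_simps)
    hence "(y - 1) * ((S + 1) * y) \<le> (y - 1) * ((T + 1) * x)" using y1 by (intro mult_left_mono) auto
    moreover have "((x - e * u1) * x) * y \<le> ((y - 1) * (S + 1)) * y"
      using low assms(1) by (intro mult_right_mono) auto
    ultimately have "((x - e * u1) * y) * x \<le> ((y - 1) * (T + 1)) * x" by (simp add: mult_ac)
    hence "(x - e * u1) * y \<le> (y - 1) * (T + 1)" using x0 by simp
    hence "x - e * u1 \<le> next_bound y" unfolding nb using assms(1) by (simp add: pos_le_divide_eq)
    thus ?thesis using y1 by simp
  qed
qed

section \<open>Monotonicity and drift of the bound\<close>

text \<open>On [1, \<infinity>) the function is a product of two nonnegative increasing factors,
  \<open>1 - 1/z\<close> and \<open>sqrt (1 + z\<^sup>2) + 1\<close>.\<close>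

lemma next_bound_mono:
  assumes "1 \<le> a" "a \<le> b"
  shows "next_bound a \<le> next_bound b"
proof -
  have eq: "next_bound z = (1 - 1/z) * (sqrt (1 + z\<^sup>2) + 1)" if "1 \<le> z" for z
    using that next_bound_eq[of z] by (simp add: field_simps)
  have "1 - 1/a \<le> 1 - 1/b" using assms by (simp add: frac_le)
  moreover have "sqrt (1 + a\<^sup>2) \<le> sqrt (1 + b\<^sup>2)" using assms by (simp add: power_mono)
  moreover have "0 \<le> 1 - 1/b" using assms by simp
  ultimately have "(1 - 1/a) * (sqrt (1 + a\<^sup>2) + 1) \<le> (1 - 1/b) * (sqrt (1 + b\<^sup>2) + 1)"
    by (intro mult_mono) auto
  thus ?thesis using assms eq by simp
qed

text \<open>The numerator \<open>(b - 1) * (T + 1)\<close> equals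
  \<open>b\<^sup>2 - (T - b) * (T + 1)\<close>, and the subtracted product is at least 1/2 because
  \<open>T - b\<close> is the reciprocal of \<open>T + b \<le> 2 * (T + 1)\<close>.\<close>

lemma next_bound_le_diff:
  assumes "0 < b"
  shows "next_bound b \<le> b - 1/(2 * b)"
proof -
  define T where "T = sqrt (1 + b\<^sup>2)"
  have T: "T\<^sup>2 = 1 + b\<^sup>2" "0 < T" by (auto simp: T_def add_pos_nonneg)
  have bT: "b < T" using T assms by - (rule power2_less_imp_less[of b T], auto)
  have 1: "(T - b) * (T + b) = 1" using T by (simp add: algebra_simps power2_eq_square)
  have "(T - b) * (T + b) \<le> (T - b) * (2 * (T + 1))" using bT by (intro mult_left_mono) auto
  hence "1/2 \<le> (T - b) * (T + 1)" using 1 by (simp add: algebra_simps)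
  also have "\<dots> = b\<^sup>2 - (b - 1) * (T + 1)" using T by (simp add: algebra_simps power2_eq_square)
  finally have "(b - 1) * (T + 1)/b \<le> (b\<^sup>2 - 1/2)/b" using assms by (intro divide_right_mono) auto
  also have "\<dots> = b - 1/(2 * b)" using assms by (simp add: field_simps power2_eq_square)
  finally show ?thesis using next_bound_eq[OF assms] unfolding T_def by simp
qed

lemma bound_seq_eventually_negative: "\<exists>t. bound_seq m0 t < 0"
proof (rule ccontr)
  assume "\<not> (\<exists>t. bound_seq m0 t < 0)"
  hence nonneg: "0 \<le> bound_seq m0 t" for t by (meson not_less)
  define b where "b t = real_of_ereal (bound_seq m0 t)" for t
  have step: "bound_seq m0 (Suc t) = bound_step (b t)" for t by (simp add: b_def)
  \<comment> \<open>A zero term would be followed by -\<infinity>, which is negative.\<close>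
  have b_nz: "b t \<noteq> 0" for t
    using nonneg[of "Suc t"] unfolding step by (auto simp: bound_step_def)
  have b_eq: "bound_seq m0 t = ereal (b t)" for t
    using b_nz[of t] unfolding b_def by (cases "bound_seq m0 t") auto
  have b_pos: "0 < b t" for t
    using nonneg[of t] b_nz[of t] by (simp add: b_eq)
  have b_Suc: "b (Suc t) = next_bound (b t)" for t
    using b_nz[of t] unfolding b_def[of "Suc t"] step bound_step_def next_bound_def by simp
  have b0: "b 0 = m0" by (simp add: b_def)
  have m0: "0 < m0" using b_pos[of 0] b0 by simp
  have "b t \<le> m0 - real t/(2 * m0)" for t
  proof (induction t)
    case (Suc t)
    have "b t \<le> m0" using Suc m0 by (smt (verit) divide_nonneg_nonneg of_nat_0_le_iff)
    hence "1/(2 * m0) \<le> 1/(2 * b t)" using b_pos[of t] by (simp add: frac_le)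
    hence "b (Suc t) \<le> b t - 1/(2 * m0)" using next_bound_le_diff[OF b_pos[of t]] b_Suc[of t] by linarith
    thus ?case using Suc by (simp add: add_divide_distrib)
  qed (simp add: b0)
  moreover obtain t where "2 * m0 * m0 < real t" using reals_Archimedean2 by blast
  hence "m0 < real t/(2 * m0)" using m0 by (simp add: pos_less_divide_eq mult_ac)
  ultimately show False using b_pos[of t] by (smt (verit))
qed

section \<open>Plane coordinates and existence of the center\<close>

lemma norm_vec2_sq: "(norm (p :: real^2))\<^sup>2 = (p$1)\<^sup>2 + (p$2)\<^sup>2"
  unfolding power2_norm_eq_inner by (simp add: inner_vec_def sum_2 power2_eq_square)

lemma vec2_eq_iff: "(p :: real^2) = q \<longleftrightarrow> p$1 = q$1 \<and> p$2 = q$2"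
  by (simp add: vec_eq_iff forall_2)

lemma coordinate_less_norm:
  fixes p :: "real^2"
  assumes "0 < p$1" "0 < p$2"
  shows "p$1 < norm p" "p$2 < norm p"
  by (rule power2_less_imp_less; use assms in \<open>simp add: norm_vec2_sq\<close>)+

text \<open>Along the ray \<open>L + \<eta> *\<^sub>R d\<close> the distance to \<open>L\<close>
  starts at 0, below both coordinates, but grows at rate \<open>n\<close>, faster than either of
  them. It meets their maximum exactly once.\<close>

lemma ex1_center:
  fixes M L :: "real^2"
  assumes "M \<in> quadrant" "M$1 < L$1" "M$2 < L$2"
  shows "\<exists>!C. is_center M L C"
proof -
  define d where "d = L - M"
  have d: "0 < d$1" "0 < d$2" using assms by (auto simp: d_def)
  have L0: "0 < L$1" "0 < L$2" using assms by (auto simp: quadrant_def)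
  define n where "n = norm d"
  have n: "d$1 < n" "d$2 < n" using coordinate_less_norm[OF d] by (auto simp: n_def)
  have cen: "is_center M L C \<longleftrightarrow>
      (\<exists>\<eta>>0. C = L + \<eta> *\<^sub>R d \<and> \<eta> * n = max (L$1 + \<eta> * d$1) (L$2 + \<eta> * d$2))" for C
    using d L0 unfolding is_center_def d_def[symmetric] n_def quadrant_def
    by (auto simp: add_nonneg_nonneg)
  show ?thesis
  proof (rule ex_ex1I)
    \<comment> \<open>Each quotient is the parameter at which the distance \<open>\<eta> * n\<close>
      catches up with one coordinate; the later of the two is the center.\<close>
    define \<eta> where "\<eta> = max (L$1 / (n - d$1)) (L$2 / (n - d$2))"
    have pos: "0 < \<eta>" using L0 n by (auto simp: \<eta>_def less_max_iff_disj)
    have "L$1 / (n - d$1) \<le> \<eta>" "L$2 / (n - d$2) \<le> \<eta>" by (auto simp: \<eta>_def)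
    hence le: "L$1 + \<eta> * d$1 \<le> \<eta> * n" "L$2 + \<eta> * d$2 \<le> \<eta> * n"
      using n by (simp_all add: pos_divide_le_eq algebra_simps)
    have "\<eta> = L$1 / (n - d$1) \<or> \<eta> = L$2 / (n - d$2)" by (auto simp: \<eta>_def max_def)
    hence "L$1 + \<eta> * d$1 = \<eta> * n \<or> L$2 + \<eta> * d$2 = \<eta> * n"
      using n by (auto simp: eq_divide_eq algebra_simps)
    hence "\<eta> * n = max (L$1 + \<eta> * d$1) (L$2 + \<eta> * d$2)" using le by (auto simp: max_def)
    thus "\<exists>C. is_center M L C" using cen pos by blast
  next
    have no: "\<not> \<eta> < \<eta>'"
      if eq: "\<eta> * n = max (L$1 + \<eta> * d$1) (L$2 + \<eta> * d$2)"
        and eq': "\<eta>' * n = max (L$1 + \<eta>' * d$1) (L$2 + \<eta>' * d$2)" for \<eta> \<eta>'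
    proof
      assume lt: "\<eta> < \<eta>'"
      have "L$1 + \<eta> * d$1 \<le> \<eta> * n" "L$2 + \<eta> * d$2 \<le> \<eta> * n" using eq by auto
      moreover have "(\<eta>' - \<eta>) * d$1 < (\<eta>' - \<eta>) * n" "(\<eta>' - \<eta>) * d$2 < (\<eta>' - \<eta>) * n"
        using lt n by auto
      ultimately have "L$1 + \<eta>' * d$1 < \<eta>' * n" "L$2 + \<eta>' * d$2 < \<eta>' * n"
        by (simp_all add: algebra_simps)
      thus False using eq' by auto
    qed
    fix C C' assume "is_center M L C" "is_center M L C'"
    thus "C = C'" unfolding cen using no by (metis linorder_neqE_linordered_idom)
  qed
qed

section \<open>One round that the man survives\<close>

text \<open>The scalar estimate takes the second coordinate as the smaller one; the other case
  follows by swapping the axes.\<close>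

lemma min_coord_decrease:
  fixes C v :: "real^2"
  assumes "norm v = 1" "0 < v$1" "0 < v$2" "0 < C$1" "0 < C$2" "0 < s"
    and "1 + (max (C$1) (C$2))\<^sup>2 \<le> s\<^sup>2"
    and "s * v$1 \<le> C$1" "s * v$2 \<le> C$2"
    and C': "C' = C - e *\<^sub>R v" "0 < C'$1" "0 < C'$2" "s - e = max (C'$1) (C'$2)"
  shows "1 < min_coord C \<and> min_coord C' \<le> next_bound (min_coord C)"
proof -
  have v: "(v$1)\<^sup>2 + (v$2)\<^sup>2 = 1" using norm_vec2_sq[of v] assms(1) by simp
  show ?thesis
  proof (cases "C$2 \<le> C$1")
    case True
    show ?thesis
      using center_coordinate_decrease[of "C$2" "C$1" "v$1" "v$2" s e] assms v True
      by (simp add: min_coord_def min_absorb2 max_absorb1)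
  next
    case False
    show ?thesis
      using center_coordinate_decrease[of "C$1" "C$2" "v$2" "v$1" s e] assms v False
      by (simp add: min_coord_def min_absorb1 max_absorb2 max.commute min.commute add.commute)
  qed
qed

text \<open>Besides the decrease, the round preserves the strict order of man and lion in both
  coordinates, which guarantees the next center.\<close>

lemma mcls_step:
  fixes M L M' :: "real^2"
  assumes MQ: "M \<in> quadrant" and man_lt: "M$1 < L$1" "M$2 < L$2"
    and move: "legal_move M M'" and escape: "1 < norm (M' - L)"
  shows "\<exists>!L'. is_mcls_point (center M L) L M' L'"
    and "legal_move L (mcls M L M')"
    and "M'$1 < mcls M L M' $1" "M'$2 < mcls M L M' $2"
    and "1 < min_coord (center M L)"
    and "min_coord (center M' (mcls M L M')) \<le> next_bound (min_coord (center M L))"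
proof -
  define C where "C = center M L"
  have "is_center M L C" unfolding C_def center_def by (rule theI'[OF ex1_center[OF MQ man_lt]])
  then obtain \<eta> where \<eta>: "0 < \<eta>" "C = L + \<eta> *\<^sub>R (L - M)" and rmax: "norm (C - L) = max (C$1) (C$2)"
    unfolding is_center_def by blast
  have M0: "0 \<le> M$1" "0 \<le> M$2" using MQ by (auto simp: quadrant_def)
  have M'0: "0 \<le> M'$1" "0 \<le> M'$2" and M'M: "norm (M' - M) \<le> 1"
    using move by (auto simp: legal_move_def quadrant_def)
  define r where "r = norm (C - L)"
  have CL: "L$1 < C$1" "L$2 < C$2" using \<eta> man_lt by auto
  have C0: "0 < C$1" "0 < C$2" using CL man_lt M0 by auto
  have r0: "0 < r" using rmax C0 by (simp add: r_def)
  define u where "u = (1/r) *\<^sub>R (C - L)"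
  have u1: "norm u = 1" using r0 by (simp add: u_def r_def)
  have u0: "0 < u$1" "0 < u$2" using CL r0 by (auto simp: u_def)
  have L: "L = C - r *\<^sub>R u" using r0 by (simp add: u_def)
  \<comment> \<open>This is the distance from \<open>C\<close> to \<open>M\<close>, since
    \<open>L - M\<close> has length \<open>r / \<eta>\<close>.\<close>
  define \<rho> where "\<rho> = r + r / \<eta>"
  have r\<rho>: "r < \<rho>" using r0 \<eta> by (simp add: \<rho>_def)
  have M: "M = C - \<rho> *\<^sub>R u"
  proof -
    have LM: "L - M = (1/\<eta>) *\<^sub>R (C - L)" using \<eta> by simp
    have "\<rho> * (1/r) = 1 + 1/\<eta>" using r0 by (simp add: \<rho>_def field_simps)
    hence "\<rho> *\<^sub>R u = (1 + 1/\<eta>) *\<^sub>R (C - L)" unfolding u_def by simp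
    also have "\<dots> = C - M" unfolding scaleR_add_left LM[symmetric] by simp
    finally show ?thesis by simp
  qed
  define w where "w = norm (C - M')"
  \<comment> \<open>At \<open>M' = C\<close> the man would have moved by \<rho> > r > 1.\<close>
  have w0: "0 < w"
  proof (rule ccontr)
    assume "\<not> 0 < w"
    hence "M' = C" by (simp add: w_def)
    hence "M' - M = \<rho> *\<^sub>R u" "M' - L = r *\<^sub>R u" using M L by simp_all
    hence "norm (M' - M) = \<rho>" "norm (M' - L) = r" using u1 r0 r\<rho> by simp_all
    thus False using M'M escape r\<rho> by simp
  qed
  define v where "v = (1/w) *\<^sub>R (C - M')"
  have v1: "norm v = 1" using w0 by (simp add: v_def w_def)
  have M': "M' = C - w *\<^sub>R v" using w0 by (simp add: v_def)
  define c where "c = inner u v"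
  have c1: "c \<le> 1" using norm_cauchy_schwarz[of u v] u1 v1 by (simp add: c_def)
  have dist_sq: "(norm ((C - t *\<^sub>R v) - (C - a *\<^sub>R u)))\<^sup>2 = a\<^sup>2 + t\<^sup>2 - 2 * a * t * c" for a t
  proof -
    have "(norm ((C - t *\<^sub>R v) - (C - a *\<^sub>R u)))\<^sup>2 = (norm (a *\<^sub>R u - t *\<^sub>R v))\<^sup>2" by simp
    also have "\<dots> = a\<^sup>2 * (norm u)\<^sup>2 + t\<^sup>2 * (norm v)\<^sup>2 - 2 * a * t * c"
      unfolding power2_norm_eq_inner c_def
      by (simp add: inner_diff_left inner_diff_right inner_commute algebra_simps power2_eq_square)
    finally show ?thesis using u1 v1 by simp
  qed
  have "(norm (M' - M))\<^sup>2 \<le> 1\<^sup>2" using M'M by (intro power_mono) auto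
  hence near: "w\<^sup>2 + \<rho>\<^sup>2 - 2 * w * \<rho> * c \<le> 1"
    using dist_sq[of w \<rho>] M' M by (simp add: algebra_simps)
  have "1\<^sup>2 < (norm (M' - L))\<^sup>2" using escape by (intro power_strict_mono) auto
  hence far: "1 < w\<^sup>2 + r\<^sup>2 - 2 * w * r * c"
    using dist_sq[of w r] M' L by (simp add: algebra_simps)
  obtain s where s: "0 < s" "s < w" "1 + r\<^sup>2 \<le> s\<^sup>2" "r\<^sup>2 + s\<^sup>2 - 2 * r * s * c = 1" and rwc: "r < w * c"
    and other: "\<And>t. r\<^sup>2 + t\<^sup>2 - 2 * r * t * c = 1 \<Longrightarrow> t \<noteq> s \<Longrightarrow> \<bar>t\<bar> < s"
    using farther_unit_circle_intersection[OF r0 r\<rho> w0 c1 near far] by metis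
  have unit: "norm (C - t *\<^sub>R v - L) = 1 \<longleftrightarrow> r\<^sup>2 + t\<^sup>2 - 2 * r * t * c = 1" for t
    using dist_sq[of t r] L by (metis norm_ge_zero one_power2 power2_eq_iff_nonneg zero_le_one)
  \<comment> \<open>The line is parametrised by the signed distance \<open>t\<close> from
    \<open>C\<close>, so the choice of \<open>L'\<close> becomes a choice between roots.\<close>
  have hull: "P \<in> affine hull {M', C} \<longleftrightarrow> (\<exists>t. P = C - t *\<^sub>R v)" for P
  proof -
    have "P \<in> affine hull {M', C} \<longleftrightarrow> (\<exists>a b. P = a *\<^sub>R M' + b *\<^sub>R C \<and> a + b = 1)"
      by (auto simp: affine_hull_2)
    also have "\<dots> \<longleftrightarrow> (\<exists>a. P = C - (a * w) *\<^sub>R v)"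
    proof -
      have "a *\<^sub>R M' + (1 - a) *\<^sub>R C = C - (a * w) *\<^sub>R v" for a
        by (simp add: M' algebra_simps)
      thus ?thesis by (metis add_diff_cancel_left' diff_add_cancel)
    qed
    also have "\<dots> \<longleftrightarrow> (\<exists>t. P = C - t *\<^sub>R v)"
      using w0 by (metis nonzero_eq_divide_eq order_less_irrefl)
    finally show ?thesis .
  qed
  define L' where "L' = C - s *\<^sub>R v"
  have L'_unit: "norm (L' - L) = 1" using unit[of s] s(4) by (simp add: L'_def)
  have L'_hull: "L' \<in> affine hull {M', C}" unfolding hull L'_def by (rule exI[of _ s]) simp
  have hullE: "\<exists>t. P = C - t *\<^sub>R v \<and> r\<^sup>2 + t\<^sup>2 - 2 * r * t * c = 1"
    if P: "P \<in> affine hull {M', C}" "norm (P - L) = 1" for P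
  proof -
    obtain t where t: "P = C - t *\<^sub>R v" using P(1) unfolding hull by blast
    have "r\<^sup>2 + t\<^sup>2 - 2 * r * t * c = 1" using P(2) unfolding t unit .
    thus ?thesis using t by auto
  qed
  have pt: "is_mcls_point C L M' P \<longleftrightarrow> P = L'" for P
  proof
    assume P: "is_mcls_point C L M' P"
    hence "P \<in> affine hull {M', C}" "norm (P - L) = 1" by (auto simp: is_mcls_point_def)
    then obtain t where t: "P = C - t *\<^sub>R v" "r\<^sup>2 + t\<^sup>2 - 2 * r * t * c = 1"
      using hullE by metis
    have "norm (L' - C) \<le> norm (P - C)"
      using P L'_hull L'_unit unfolding is_mcls_point_def by simp
    hence "s \<le> \<bar>t\<bar>" using t v1 s by (simp add: L'_def)
    thus "P = L'" using other[OF t(2)] t(1) by (cases "t = s") (simp_all add: L'_def)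
  next
    assume P: "P = L'"
    have "norm (Q - C) \<le> norm (L' - C)" if Q: "Q \<in> affine hull {M', C}" "norm (Q - L) = 1" for Q
    proof -
      obtain t where t: "Q = C - t *\<^sub>R v" "r\<^sup>2 + t\<^sup>2 - 2 * r * t * c = 1"
        using hullE[OF Q] by metis
      have "\<bar>t\<bar> \<le> s" using other[OF t(2)] s(1) by (cases "t = s") simp_all
      thus ?thesis using t v1 s by (simp add: L'_def)
    qed
    thus "is_mcls_point C L M' P"
      unfolding P is_mcls_point_def using L'_hull L'_unit by simp
  qed
  thus ex1: "\<exists>!L'. is_mcls_point (center M L) L M' L'" unfolding C_def[symmetric] pt by simp
  have L'_eq: "mcls M L M' = L'"
  proof -
    have "(THE P. is_mcls_point C L M' P) = L'" by (rule the_equality) (use pt in auto)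
    thus ?thesis using escape unfolding mcls_def C_def[symmetric] by simp
  qed
  have "inner (C - M') u = w * c" by (simp add: M' c_def inner_commute)
  hence key: "r < (C$1 - M'$1) * u$1 + (C$2 - M'$2) * u$2"
    using rwc by (simp add: inner_vec_def sum_2)
  \<comment> \<open>Each term of the sum in \<open>key\<close> is less than \<open>r\<close>, as \<open>C$i \<le> r\<close> and \<open>u$i < 1\<close>; so both are positive.\<close>
  have below: "M'$1 < C$1" "M'$2 < C$2"
  proof -
    have Cr: "C$1 \<le> r" "C$2 \<le> r" using rmax by (simp_all add: r_def)
    have ul: "u$1 < 1" "u$2 < 1" using coordinate_less_norm[OF u0] u1 by auto
    have "(C$1 - M'$1) * u$1 \<le> r * u$1" "(C$2 - M'$2) * u$2 \<le> r * u$2"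
      using Cr M'0 u0 by (auto intro!: mult_right_mono)
    moreover have "r * u$1 < r" "r * u$2 < r" using ul r0 by auto
    ultimately have "0 < (C$1 - M'$1) * u$1" "0 < (C$2 - M'$2) * u$2" using key by linarith+
    thus "M'$1 < C$1" "M'$2 < C$2" using u0 by (auto simp: zero_less_mult_iff)
  qed
  hence v0: "0 < v$1" "0 < v$2" using w0 by (auto simp: v_def)
  \<comment> \<open>\<open>L'\<close> lies strictly between \<open>M'\<close> and \<open>C\<close>,
    as \<open>s < w\<close>; in particular it stays in the quadrant.\<close>
  have man_lt': "M'$1 < L'$1" "M'$2 < L'$2"
    using s v0 by (auto simp: M' L'_def)
  show "M'$1 < mcls M L M' $1" "M'$2 < mcls M L M' $2" unfolding L'_eq by fact+
  show "legal_move L (mcls M L M')"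
    using L'_unit man_lt' M'0 unfolding L'_eq legal_move_def quadrant_def by auto
  have M'Q: "M' \<in> quadrant" using M'0 by (simp add: quadrant_def)
  define C' where "C' = center M' L'"
  have "is_center M' L' C'" unfolding C'_def center_def by (rule theI'[OF ex1_center[OF M'Q man_lt']])
  then obtain \<eta>' where \<eta>': "0 < \<eta>'" "C' = L' + \<eta>' *\<^sub>R (L' - M')" and rmax': "norm (C' - L') = max (C'$1) (C'$2)"
    unfolding is_center_def by blast
  \<comment> \<open>The new radius: \<open>L' - M'\<close> has length \<open>w - s\<close>.\<close>
  define r' where "r' = \<eta>' * (w - s)"
  have C'L': "C' = L' + r' *\<^sub>R v" unfolding \<eta>'(2) r'_def by (simp add: L'_def M' algebra_simps)
  have r'0: "0 < r'" using \<eta>' s by (simp add: r'_def)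
  have C'e: "C' = C - (s - r') *\<^sub>R v" by (simp add: C'L' L'_def algebra_simps)
  have r'max: "s - (s - r') = max (C'$1) (C'$2)"
    using rmax' r'0 v1 by (simp add: C'L')
  have C'0: "0 < C'$1" "0 < C'$2" using man_lt' M'0 r'0 v0 by (auto simp: C'L' add_pos_pos)
  have sC: "s * v$1 \<le> C$1" "s * v$2 \<le> C$2" using man_lt' M'0 by (auto simp: L'_def)
  have sm: "1 + (max (C$1) (C$2))\<^sup>2 \<le> s\<^sup>2" using s(3) rmax by (simp add: r_def)
  show "1 < min_coord (center M L)"
    and "min_coord (center M' (mcls M L M')) \<le> next_bound (min_coord (center M L))"
    using min_coord_decrease[OF v1 v0 C0 s(1) sm sC C'e C'0 r'max]
    unfolding L'_eq C'_def[symmetric] C_def[symmetric] by auto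
qed

lemma center_pos:
  fixes M L :: "real^2"
  assumes "M \<in> quadrant" "M$1 < L$1" "M$2 < L$2"
  shows "0 < min_coord (center M L)"
proof -
  have "is_center M L (center M L)" unfolding center_def by (rule theI'[OF ex1_center[OF assms]])
  then obtain \<eta> where "0 < \<eta>" "center M L = L + \<eta> *\<^sub>R (L - M)" unfolding is_center_def by blast
  thus ?thesis using assms by (auto simp: min_coord_def quadrant_def intro!: add_nonneg_pos add_pos_pos)
qed

section \<open>The whole play\<close>

theorem mainTheorem3:
  fixes M0 L0 :: "real^2" and m0 :: real and \<sigma> :: man_strategy
  assumes "M0 \<in> quadrant" and "L0 \<in> quadrant"
    and "M0$1 < L0$1" and "M0$2 < L0$2"
    and "m0 = min_coord (center M0 L0)"
    and "m0 > 1"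
    and "legal_man_strategy \<sigma>"
  shows "(\<exists>!C. is_center M0 L0 C) \<and>
    (\<forall>t. mcls_admissible (man_pos \<sigma> M0 L0 t) (lion_pos \<sigma> M0 L0 t) (man_pos \<sigma> M0 L0 (Suc t))) \<and>
    (\<exists>t. bound_seq m0 t < 0) \<and>
    (\<exists>T \<le> N_max m0. captured_at \<sigma> M0 L0 T)"
proof -
  define h where "h t = mcls_history \<sigma> M0 L0 t" for t
  define M where "M t = man_pos \<sigma> M0 L0 t" for t
  define L where "L t = lion_pos \<sigma> M0 L0 t" for t
  define chase where "chase t \<longleftrightarrow> M t$1 < L t$1 \<and> M t$2 < L t$2" for t
  have h_last: "last (h t) = (M t, L t)" for t
    by (simp add: h_def M_def L_def man_pos_def lion_pos_def)
  have h_Suc: "h (Suc t) = h t @ [(\<sigma> (h t), mcls (M t) (L t) (\<sigma> (h t)))]" for t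
    using h_last[of t] by (simp add: h_def Let_def)
  have M_Suc: "M (Suc t) = \<sigma> (h t)" and L_Suc: "L (Suc t) = mcls (M t) (L t) (M (Suc t))" for t
    using h_last[of "Suc t"] by (auto simp: h_Suc)
  have start: "h 0 = [(M0, L0)]" "M 0 = M0" "L 0 = L0"
    by (simp_all add: h_def M_def L_def man_pos_def lion_pos_def)
  have h_ne: "h t \<noteq> []" for t by (cases t) (simp_all add: start h_Suc)
  have legal: "legal_move (M t) (M (Suc t))" if "set (h t) \<subseteq> quadrant \<times> quadrant" for t
    using assms(7) that h_ne[of t] h_last[of t] unfolding legal_man_strategy_def M_Suc by fastforce
  have pos_Q: "M t \<in> quadrant \<and> L t \<in> quadrant" if "set (h t) \<subseteq> quadrant \<times> quadrant" for t
    using that last_in_set[OF h_ne[of t]] h_last[of t] by auto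
  have step: "mcls_admissible (M t) (L t) (M (Suc t)) \<and> (L (Suc t) = M (Suc t) \<or>
      chase (Suc t) \<and> 1 < min_coord (center (M t) (L t)) \<and>
      min_coord (center (M (Suc t)) (L (Suc t))) \<le> next_bound (min_coord (center (M t) (L t))))"
    if hQ: "set (h t) \<subseteq> quadrant \<times> quadrant" and good: "L t = M t \<or> chase t" for t
  proof (cases "norm (M (Suc t) - L t) \<le> 1")
    case True
    thus ?thesis using legal[OF hQ]
      by (auto simp: L_Suc mcls_def mcls_admissible_def legal_move_def)
  next
    case False
    hence "L t \<noteq> M t" using legal[OF hQ] by (auto simp: legal_move_def)
    hence lt: "M t$1 < L t$1" "M t$2 < L t$2" using good by (auto simp: chase_def)
    have MQ: "M t \<in> quadrant" using pos_Q[OF hQ] by simp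
    have far: "1 < norm (M (Suc t) - L t)" using False by simp
    note st = mcls_step[OF MQ lt legal[OF hQ] far]
    show ?thesis
      using st ex1_center[OF MQ lt] by (simp add: mcls_admissible_def chase_def L_Suc)
  qed
  \<comment> \<open>The whole history is tracked because \<sigma> is only known to be legal on
    histories inside the quadrant.\<close>
  have inv: "set (h t) \<subseteq> quadrant \<times> quadrant \<and> (L t = M t \<or> chase t)" for t
  proof (induction t)
    case 0
    show ?case using assms(1-4) by (simp add: start chase_def)
  next
    case (Suc t)
    hence hQ: "set (h t) \<subseteq> quadrant \<times> quadrant" and st: "L t = M t \<or> chase t" by auto
    have "M (Suc t) \<in> quadrant" using legal[OF hQ] by (simp add: legal_move_def)
    moreover have "L (Suc t) \<in> quadrant"
      using step[OF hQ st] by (simp add: mcls_admissible_def legal_move_def L_Suc)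
    ultimately show ?case
      using hQ step[OF hQ st] by (auto simp: h_Suc M_Suc[symmetric] L_Suc[symmetric])
  qed
  have adm: "mcls_admissible (M t) (L t) (M (Suc t))" for t using step inv by blast
  have captured_stays: "L (Suc t) = M (Suc t)" if "L t = M t" for t
    using legal inv that by (simp add: L_Suc mcls_def legal_move_def)
  have bound: "L t = M t \<or> chase t \<and> ereal (min_coord (center (M t) (L t))) \<le> bound_seq m0 t" for t
  proof (induction t)
    case 0
    show ?case using assms(3,4,5) by (simp add: start chase_def)
  next
    case (Suc t)
    show ?case
    proof (cases "L (Suc t) = M (Suc t)")
      case False
      define a where "a = min_coord (center (M t) (L t))"
      have old: "chase t" "ereal a \<le> bound_seq m0 t"
        using Suc False captured_stays unfolding a_def by auto
      have new: "chase (Suc t)" "1 < a" "min_coord (center (M (Suc t)) (L (Suc t))) \<le> next_bound a"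
        using step[of t] inv[of t] False unfolding a_def by auto
      have "0 < min_coord (center (M (Suc t)) (L (Suc t)))"
        using center_pos[of "M (Suc t)" "L (Suc t)"] pos_Q inv new(1) by (simp add: chase_def)
      show ?thesis
      proof (cases "bound_seq m0 t")
        case (real b)
        hence "a \<le> b" using old(2) by simp
        \<comment> \<open>\<open>1 < a\<close> puts both arguments where the recursion is monotone,
          and \<open>b \<noteq> 0\<close> excludes the special value of
          \<open>bound_step\<close>.\<close>
        hence "next_bound a \<le> next_bound b" "b \<noteq> 0" using new(2) next_bound_mono[of a b] by auto
        thus ?thesis using new real by (simp add: bound_step_def next_bound_def)
      next
        case PInf
        have "bound_seq m0 t \<noteq> \<infinity>" by (cases t) (auto simp: bound_step_def)
        thus ?thesis using PInf by simp
      next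
        case MInf
        thus ?thesis using old(2) by simp
      qed
    qed simp
  qed
  have neg: "\<exists>t. bound_seq m0 t < 0" by (rule bound_seq_eventually_negative)
  hence "bound_seq m0 (N_max m0) < 0" unfolding N_max_def by (rule LeastI_ex)
  moreover have "0 < min_coord (center (M t) (L t))" if "chase t" for t
    using that center_pos[of "M t" "L t"] pos_Q inv by (simp add: chase_def)
  \<comment> \<open>A free man would have a positive \<open>min_coord\<close> of the center below a
    negative bound.\<close>
  ultimately have "L (N_max m0) = M (N_max m0)"
    using bound[of "N_max m0"] by (metis ereal_less(2) less_le_trans not_less_iff_gr_or_eq)
  hence "captured_at \<sigma> M0 L0 (N_max m0)" by (simp add: captured_at_def L_def M_def)
  thus ?thesis
    using ex1_center[OF assms(1,3,4)] adm neg unfolding M_def L_def by blast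
qed

end
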